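(* Let $T_1,T_2,T_3,T_4\in\mathcal{B}_A(\mathcal{H})$. Then $$w_{\mathbb{A}}\left(\begin{bmatrix}T_1&T_2\\ T_3&T_4\end{bmatrix}\right)\ge\frac12\max\{\alpha,\beta\},$$ where $\alpha=\max\{w_A(T_1+T_2+T_3+T_4),\ w_A(T_1+T_4-T_2-T_3)\}$ and $\beta=\max\{w_A(T_1+T_4+i(T_2-T_3)),\ w_A(T_1+T_4-i(T_2-T_3))\}$.
   Context: $\mathcal{H}$ is a complex Hilbert space with inner product $\langle\cdot,\cdot\rangle$, $\mathcal{B}(\mathcal{H})$ is the algebra of bounded linear operators on $\mathcal{H}$, and $A\in\mathcal{B}(\mathcal{H})$ is a positive operator, i.e. $A$ is selfadjoint and $\langle Ax,x\rangle\ge 0$ for all $x$. Put $\langle x,y\rangle_A=\langle Ax,y\rangle$ and $\|x\|_A=\sqrt{\langle x,x\rangle_A}$. $\mathcal{R}(\cdot)$ denotes range, and $\mathcal{B}_A(\mathcal{H})=\{T\in\mathcal{B}(\mathcal{H}):\mathcal{R}(T^*A)\subseteq\mathcal{R}(A)\}$ (the operators admitting an $A$-adjoint, i.e. some $X\in\mathcal{B}(\mathcal{H})$ with $AX=T^*A$). The $A$-numerical radius is $w_A(T)=\sup\{|\langle Tx,x\rangle_A|:x\in\mathcal{H},\ \|x\|_A=1\}$. $\mathbb{A}=\mathrm{diag}(A,A)$ is the positive operator on $\mathcal{H}\oplus\mathcal{H}$ with diagonal entries $A$, and $w_{\mathbb{A}}$ is defined in the same way with $\mathcal{H}\oplus\mathcal{H}$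 and $\mathbb{A}$ in place of $\mathcal{H}$ and $A$. *)

theory Defs
  imports "HOL-Analysis.Analysis"
begin

section \<open>Complex Hilbert spaces\<close>

class complex_vector = real_vector +
  fixes scaleC :: "complex \<Rightarrow> 'a \<Rightarrow> 'a"  (infixr \<open>*\<^sub>C\<close> 75)
  assumes scaleC_add_right: "a *\<^sub>C (x + y) = a *\<^sub>C x + a *\<^sub>C y"
    and scaleC_add_left: "(a + b) *\<^sub>C x = a *\<^sub>C x + b *\<^sub>C x"
    and scaleC_scaleC: "a *\<^sub>C b *\<^sub>C x = (a * b) *\<^sub>C x"
    and scaleC_one: "1 *\<^sub>C x = x"
    and scaleR_scaleC: "r *\<^sub>R x = complex_of_real r *\<^sub>C x"

text \<open>The inner product \<open>cinner\<close> is linear in its first argument. The library norm of the class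
  \<^class>\<open>real_inner\<close> is \<open>sqrt (inner x x)\<close>, hence the last axiom makes it the norm induced by
  \<open>cinner\<close>, and makes \<open>cinner\<close> positive definite.\<close>

class complex_inner = complex_vector + real_inner +
  fixes cinner :: "'a \<Rightarrow> 'a \<Rightarrow> complex"
  assumes cinner_commute: "cinner x y = cnj (cinner y x)"
    and cinner_add_left: "cinner (x + y) z = cinner x z + cinner y z"
    and cinner_scaleC_left: "cinner (c *\<^sub>C x) y = c * cinner x y"
    and inner_eq_Re_cinner: "inner x y = Re (cinner x y)"

class chilbert_space = complex_inner + complete_space

lemma cinner_self: "cinner x x = complex_of_real ((norm x)\<^sup>2)"
proof (rule complex_eqI)
  show "Re (cinner x x) = Re (complex_of_real ((norm x)\<^sup>2))"
    by (simp add: power2_norm_eq_inner inner_eq_Re_cinner)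
  show "Im (cinner x x) = Im (complex_of_real ((norm x)\<^sup>2))"
    using arg_cong[OF cinner_commute[of x x], of Im] by simp
qed

text \<open>The orthogonal direct sum of two complex Hilbert spaces.\<close>

instantiation prod :: (complex_vector, complex_vector) complex_vector
begin

definition scaleC_prod_def: "c *\<^sub>C p = (c *\<^sub>C fst p, c *\<^sub>C snd p)"

instance
  by standard
    (auto simp: scaleC_prod_def scaleC_add_right scaleC_add_left scaleC_scaleC scaleC_one
      scaleR_scaleC prod_eq_iff)

end

instantiation prod :: (complex_inner, complex_inner) complex_inner
begin

definition cinner_prod_def: "cinner p q = cinner (fst p) (fst q) + cinner (snd p) (snd q)"

instance
proof
  fix p q r :: "'a \<times> 'b" and c :: complex
  show "cinner p q = cnj (cinner q p)"
    unfolding cinner_prod_def complex_cnj_add by (simp flip: cinner_commute)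
  show "cinner (p + q) r = cinner p r + cinner q r"
    by (simp add: cinner_prod_def cinner_add_left)
  show "cinner (c *\<^sub>C p) q = c * cinner p q"
    by (simp add: cinner_prod_def scaleC_prod_def cinner_scaleC_left distrib_left)
  show "inner p q = Re (cinner p q)"
    by (simp add: cinner_prod_def inner_prod_def inner_eq_Re_cinner)
qed

end

instance prod :: (chilbert_space, chilbert_space) chilbert_space ..


section \<open>Bounded operators, adjoints and positivity\<close>

definition bounded_clinear :: "('a::complex_inner \<Rightarrow> 'b::complex_inner) \<Rightarrow> bool" where
  "bounded_clinear T \<longleftrightarrow> bounded_linear T \<and> (\<forall>c x. T (c *\<^sub>C x) = c *\<^sub>C T x)"

definition cadjoint :: "('a::complex_inner \<Rightarrow> 'b::complex_inner) \<Rightarrow> 'b \<Rightarrow> 'a" where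
  "cadjoint T = (THE S. \<forall>x y. cinner (T x) y = cinner x (S y))"

definition positive_op :: "('a::complex_inner \<Rightarrow> 'a) \<Rightarrow> bool" where
  "positive_op A \<longleftrightarrow>
     bounded_clinear A \<and> cadjoint A = A \<and> (\<forall>x. cinner (A x) x \<in> \<real>\<^sub>\<ge>\<^sub>0)"

text \<open>The description in \<^const>\<open>cadjoint\<close> is proper for bounded operators on a Hilbert space.
  This rests on the Riesz representation theorem, proved by minimising
  \<open>(norm x)\<^sup>2 - 2 * f x\<close>.\<close>

lemma riesz_real:
  fixes f :: "'a::{real_inner, complete_space} \<Rightarrow> real"
  assumes "bounded_linear f"
  shows "\<exists>y. \<forall>z. f z = inner z y"
proof -
  interpret f: bounded_linear f by fact
  define J where "J x = inner x x - 2 * f x" for x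
  obtain K where K: "\<And>x. norm (f x) \<le> norm x * K" using f.bounded by blast
  have lower: "J x \<ge> - K\<^sup>2" for x
  proof -
    have "f x \<le> norm x * K" using K[of x] by simp
    moreover have "(norm x - K)\<^sup>2 \<ge> 0" by simp
    ultimately show ?thesis
      by (simp add: J_def dot_square_norm power2_diff)
  qed
  define m where "m = (INF x. J x)"
  have bdd: "bdd_below (range J)" unfolding bdd_below_def using lower by blast
  have m_le: "m \<le> J x" for x unfolding m_def by (rule cINF_lower[OF bdd]) simp
  have "\<exists>x. J x < m + inverse (real (Suc n))" for n
  proof -
    have "Inf (range J) < m + inverse (real (Suc n))"
      unfolding m_def[symmetric] by simp
    then show ?thesis using cInf_lessD[of "range J"] by fastforce
  qed
  then obtain X where X: "\<And>n. J (X n) < m + inverse (real (Suc n))" by metis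
  have par: "(norm (x - y))\<^sup>2 = 2 * J x + 2 * J y - 4 * J ((1/2) *\<^sub>R (x + y))" for x y
    unfolding J_def f.scaleR f.add power2_norm_eq_inner
    by (simp add: inner_add inner_diff inner_commute algebra_simps)
  have "Cauchy X"
  proof (rule metric_CauchyI)
    fix e :: real assume e: "e > 0"
    obtain N where N: "inverse (real (Suc N)) < e\<^sup>2 / 4"
      using e reals_Archimedean[of "e\<^sup>2 / 4"] by auto
    have "dist (X i) (X j) < e" if "i \<ge> N" "j \<ge> N" for i j
    proof -
      have inv: "inverse (real (Suc k)) \<le> inverse (real (Suc N))" if "k \<ge> N" for k
        using that by (intro le_imp_inverse_le) auto
      have "J (X i) < m + e\<^sup>2 / 4" "J (X j) < m + e\<^sup>2 / 4"
        using X[of i] X[of j] N inv[OF that(1)] inv[OF that(2)] by linarith+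
      then have "(norm (X i - X j))\<^sup>2 < e\<^sup>2"
        using par[of "X i" "X j"] m_le[of "(1/2) *\<^sub>R (X i + X j)"] by linarith
      then show ?thesis using e by (simp add: dist_norm power_less_imp_less_base)
    qed
    then show "\<exists>M. \<forall>i\<ge>M. \<forall>j\<ge>M. dist (X i) (X j) < e" by blast
  qed
  then obtain y where y: "X \<longlonglongrightarrow> y" using Cauchy_convergent convergent_def by blast
  have "(\<lambda>n. J (X n)) \<longlonglongrightarrow> J y"
    unfolding J_def by (intro tendsto_intros f.tendsto y)
  moreover have "(\<lambda>n. m + inverse (real (Suc n))) \<longlonglongrightarrow> m + 0"
    by (intro tendsto_intros LIMSEQ_inverse_real_of_nat)
  ultimately have "J y \<le> m"
    using X LIMSEQ_le[of "\<lambda>n. J (X n)"] by (force intro: less_imp_le)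
  have "f z = inner z y" for z
  proof (cases "z = 0")
    case False
    define c where "c = f z - inner z y"
    have "0 \<le> J (y + t *\<^sub>R z) - J y" for t
      using \<open>J y \<le> m\<close> m_le[of "y + t *\<^sub>R z"] by linarith
    also have "J (y + t *\<^sub>R z) - J y = t\<^sup>2 * inner z z - 2 * t * c" for t
      unfolding J_def c_def f.scaleR f.add
      by (simp add: inner_add inner_commute algebra_simps power2_eq_square)
    finally have q: "0 \<le> t\<^sup>2 * inner z z - 2 * t * c" for t .
    have "0 \<le> - (c\<^sup>2 / inner z z)"
      using q[of "c / inner z z"] False by (simp add: field_simps power2_eq_square)
    moreover have "inner z z > 0" using False by simp
    ultimately have "c\<^sup>2 \<le> 0" by (auto simp: divide_le_0_iff)
    then show ?thesis by (simp add: c_def)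
  qed (simp add: f.zero)
  then show ?thesis by blast
qed

lemma cadjoint_eq:
  fixes T :: "'a::chilbert_space \<Rightarrow> 'b::chilbert_space"
  assumes "bounded_clinear T"
  shows "cinner (T x) y = cinner x (cadjoint T y)"
proof -
  have lin: "bounded_linear T" and sc: "\<And>c x. T (c *\<^sub>C x) = c *\<^sub>C T x"
    using assms by (auto simp: bounded_clinear_def)
  have Im_cinner: "Im (cinner u v) = Re (cinner ((- \<i>) *\<^sub>C u) v)"
    for u v :: "'c::chilbert_space"
    by (simp add: cinner_scaleC_left)
  have "\<exists>w. \<forall>x. cinner (T x) y = cinner x w" for y
  proof -
    have "bounded_linear (\<lambda>x. inner (T x) y)"
      using bounded_linear_compose[OF bounded_linear_inner_left lin] by simp
    then obtain w where "\<And>z. inner (T z) y = inner z w" using riesz_real by blast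
    then have Re: "Re (cinner (T z) y) = Re (cinner z w)" for z
      by (simp add: inner_eq_Re_cinner)
    have "Im (cinner (T z) y) = Im (cinner z w)" for z
      unfolding Im_cinner sc[symmetric] by (rule Re)
    with Re show ?thesis by (auto intro: complex_eqI)
  qed
  then obtain S where S: "\<forall>x y. cinner (T x) y = cinner x (S y)" by metis
  moreover have "S' = S" if "\<forall>x y. cinner (T x) y = cinner x (S' y)" for S'
  proof
    fix y
    have "inner (S' y - S y) (S' y) = inner (S' y - S y) (S y)"
      unfolding inner_eq_Re_cinner using that S by metis
    then have "inner (S' y - S y) (S' y - S y) = 0" by (simp add: inner_diff_right)
    then show "S' y = S y" by simp
  qed
  ultimately have "\<forall>x y. cinner (T x) y = cinner x (cadjoint T y)"
    unfolding cadjoint_def by (rule theI)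
  then show ?thesis by blast
qed


section \<open>The semi-inner product induced by a positive operator\<close>

definition A_inner :: "('a::complex_inner \<Rightarrow> 'a) \<Rightarrow> 'a \<Rightarrow> 'a \<Rightarrow> complex" where
  "A_inner A x y = cinner (A x) y"

definition A_norm :: "('a::complex_inner \<Rightarrow> 'a) \<Rightarrow> 'a \<Rightarrow> real" where
  "A_norm A x = sqrt (Re (A_inner A x x))"

definition A_adjointable :: "('a::complex_inner \<Rightarrow> 'a) \<Rightarrow> ('a \<Rightarrow> 'a) set" where
  "A_adjointable A = {T. bounded_clinear T \<and> range (cadjoint T \<circ> A) \<subseteq> range A}"

text \<open>The supremum is taken in \<open>[0, \<infinity>]\<close>, so no boundedness side condition is needed, and it is
  \<open>0\<close> in the degenerate case \<open>A = 0\<close>, where no vector has \<open>A\<close>-norm \<open>1\<close>.\<close>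

definition A_numerical_radius :: "('a::complex_inner \<Rightarrow> 'a) \<Rightarrow> ('a \<Rightarrow> 'a) \<Rightarrow> ennreal" where
  "A_numerical_radius A T = (SUP x\<in>{x. A_norm A x = 1}. ennreal (cmod (A_inner A (T x) x)))"

definition op_matrix ::
  "('a::complex_inner \<Rightarrow> 'a) \<Rightarrow> ('a \<Rightarrow> 'a) \<Rightarrow> ('a \<Rightarrow> 'a) \<Rightarrow> ('a \<Rightarrow> 'a) \<Rightarrow> 'a \<times> 'a \<Rightarrow> 'a \<times> 'a"
where
  "op_matrix P Q R S = (\<lambda>(x, y). (P x + Q y, R x + S y))"

definition op_diag :: "('a::complex_inner \<Rightarrow> 'a) \<Rightarrow> 'a \<times> 'a \<Rightarrow> 'a \<times> 'a" where
  "op_diag A = op_matrix A (\<lambda>_. 0) (\<lambda>_. 0) A"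

end

theory Submission
  imports Defs
begin

text \<open>The lower bound comes from evaluating the quadratic form of the block matrix only on the
  vectors \<open>p = (x, u x) / sqrt 2\<close> with \<open>\<bar>u\<bar> = 1\<close>. If \<open>x\<close> has \<open>A\<close>-norm \<open>1\<close>, so does
  \<open>p\<close>, both components contributing \<open>1 / 2\<close>; and since \<open>u * cnj u = 1\<close>, the quadratic form of
  the matrix at \<open>p\<close> is half the quadratic form at \<open>x\<close> of the single operator
  \<open>T\<^sub>1 + u T\<^sub>2 + cnj u T\<^sub>3 + T\<^sub>4\<close>. Taking suprema over \<open>x\<close> bounds the \<open>A\<close>-numerical radius of
  this operator by twice that of the matrix, for every \<open>u\<close> on the unit circle. The four
  operators of the theorem are the cases \<open>u = 1, -1, \<i>, -\<i>\<close>.\<close>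

lemma cinner_scaleC_right: "cinner x (c *\<^sub>C y) = cnj c * cinner x y"
  by (metis cinner_commute cinner_scaleC_left complex_cnj_mult)

lemma scaleC_minus_one: "(- 1) *\<^sub>C x = - x"
  using scaleR_scaleC[of "- 1" x] by simp

lemma scaleC_minus_left: "(- c) *\<^sub>C x = - (c *\<^sub>C x)"
  using scaleC_scaleC[of "- 1" c x] by (simp add: scaleC_minus_one)

lemma scaleC_diff_right: "c *\<^sub>C (x - y) = c *\<^sub>C x - c *\<^sub>C y"
  using scaleC_add_right[of c "x - y" y] by (simp add: algebra_simps)

lemma bounded_clinear_add: "bounded_clinear T \<Longrightarrow> T (x + y) = T x + T y"
  by (simp add: bounded_clinear_def linear_simps)

lemma bounded_clinear_scaleC: "bounded_clinear T \<Longrightarrow> T (c *\<^sub>C x) = c *\<^sub>C T x"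
  by (simp add: bounded_clinear_def)

lemma A_inner_op_diag:
  "A_inner (op_diag A) (x, y) (z, w) = A_inner A x z + A_inner A y w"
  by (simp add: A_inner_def op_diag_def op_matrix_def cinner_prod_def)

lemma A_inner_add_left:
  "bounded_clinear A \<Longrightarrow> A_inner A (x + y) z = A_inner A x z + A_inner A y z"
  by (simp add: A_inner_def bounded_clinear_add cinner_add_left)

lemma A_inner_scaleC_left:
  "bounded_clinear A \<Longrightarrow> A_inner A (c *\<^sub>C x) y = c * A_inner A x y"
  by (simp add: A_inner_def bounded_clinear_scaleC cinner_scaleC_left)

lemma A_inner_scaleC_right: "A_inner A x (c *\<^sub>C y) = cnj c * A_inner A x y"
  by (simp add: A_inner_def cinner_scaleC_right)

text \<open>Each \<open>x\<close> is compared with the test vector \<open>(c x, c u x)\<close>, where \<open>c = 1 / sqrt 2\<close>. The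
  off-diagonal blocks pair different components of it, so \<open>Q\<close> picks up the factor \<open>u\<close> and \<open>R\<close>
  the factor \<open>cnj u\<close>, while the two phases cancel in the term of \<open>S\<close>.\<close>

lemma half_A_numerical_radius_twisted_sum_le:
  fixes A P Q R S :: "'a::complex_inner \<Rightarrow> 'a"
  assumes A: "bounded_clinear A"
    and lin: "bounded_clinear P" "bounded_clinear Q" "bounded_clinear R" "bounded_clinear S"
    and u: "cmod u = 1"
  shows "1 / 2 * A_numerical_radius A (\<lambda>x. P x + u *\<^sub>C Q x + cnj u *\<^sub>C R x + S x)
    \<le> A_numerical_radius (op_diag A) (op_matrix P Q R S)"
proof -
  let ?T = "\<lambda>x. P x + u *\<^sub>C Q x + cnj u *\<^sub>C R x + S x"
  let ?M = "op_matrix P Q R S"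
  define c where "c = complex_of_real (1 / sqrt 2)"
  have cc: "c * cnj c = 1 / 2"
  proof -
    have "complex_of_real (sqrt 2) * complex_of_real (sqrt 2) = 2"
      by (simp flip: of_real_mult)
    then show ?thesis by (simp add: c_def)
  qed
  have uu: "u * cnj u = 1"
    using u by (simp add: complex_norm_square[symmetric])
  have "1 / 2 * ennreal (cmod (A_inner A (?T x) x)) \<le> A_numerical_radius (op_diag A) ?M"
    if x: "A_norm A x = 1" for x
  proof -
    let ?p = "(c *\<^sub>C x, c *\<^sub>C u *\<^sub>C x)"
    have "A_inner (op_diag A) ?p ?p
        = (c * cnj c) * A_inner A x x + (c * cnj c) * (u * cnj u) * A_inner A x x"
      by (simp add: A_inner_op_diag A_inner_scaleC_left[OF A] A_inner_scaleC_right algebra_simps)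
    also have "\<dots> = A_inner A x x" by (simp add: cc uu)
    finally have norm_p: "A_norm (op_diag A) ?p = 1" using x by (simp add: A_norm_def)
    have "A_inner (op_diag A) (?M ?p) ?p
        = (c * cnj c) * (A_inner A (P x) x + u * A_inner A (Q x) x + cnj u * A_inner A (R x) x
            + (u * cnj u) * A_inner A (S x) x)"
      by (simp add: op_matrix_def A_inner_op_diag lin[THEN bounded_clinear_scaleC]
          A_inner_add_left[OF A] A_inner_scaleC_left[OF A] A_inner_scaleC_right algebra_simps)
    also have "\<dots> = 1 / 2 * A_inner A (?T x) x"
      by (simp add: cc uu A_inner_add_left[OF A] A_inner_scaleC_left[OF A])
    finally have "cmod (A_inner (op_diag A) (?M ?p) ?p) = 1 / 2 * cmod (A_inner A (?T x) x)"
      by (simp only: norm_mult norm_divide norm_one norm_numeral)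
    then have "ennreal (cmod (A_inner (op_diag A) (?M ?p) ?p))
        = ennreal (1 / 2) * ennreal (cmod (A_inner A (?T x) x))"
      by (simp only: ennreal_mult'' norm_ge_zero)
    moreover have "ennreal (1 / 2) = 1 / 2"
      by (simp add: divide_ennreal[symmetric] divide_ennreal_def)
    moreover have "ennreal (cmod (A_inner (op_diag A) (?M ?p) ?p))
        \<le> A_numerical_radius (op_diag A) ?M"
      unfolding A_numerical_radius_def by (rule SUP_upper) (simp add: norm_p)
    ultimately show ?thesis by simp
  qed
  then show ?thesis
    unfolding A_numerical_radius_def[of A] SUP_mult_left_ennreal
    by (intro SUP_least) simp
qed

theorem theorem3p10:
  fixes A T\<^sub>1 T\<^sub>2 T\<^sub>3 T\<^sub>4 :: "'a::chilbert_space \<Rightarrow> 'a"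
  assumes "positive_op A"
    and "T\<^sub>1 \<in> A_adjointable A" and "T\<^sub>2 \<in> A_adjointable A"
    and "T\<^sub>3 \<in> A_adjointable A" and "T\<^sub>4 \<in> A_adjointable A"
  shows "A_numerical_radius (op_diag A) (op_matrix T\<^sub>1 T\<^sub>2 T\<^sub>3 T\<^sub>4) \<ge>
    1 / 2 * max
      (max (A_numerical_radius A (\<lambda>x. T\<^sub>1 x + T\<^sub>2 x + T\<^sub>3 x + T\<^sub>4 x))
           (A_numerical_radius A (\<lambda>x. T\<^sub>1 x + T\<^sub>4 x - T\<^sub>2 x - T\<^sub>3 x)))
      (max (A_numerical_radius A (\<lambda>x. T\<^sub>1 x + T\<^sub>4 x + \<i> *\<^sub>C (T\<^sub>2 x - T\<^sub>3 x)))
           (A_numerical_radius A (\<lambda>x. T\<^sub>1 x + T\<^sub>4 x - \<i> *\<^sub>C (T\<^sub>2 x - T\<^sub>3 x))))"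
proof -
  have A: "bounded_clinear A"
    using assms(1) by (simp add: positive_op_def)
  have lin: "bounded_clinear T\<^sub>1" "bounded_clinear T\<^sub>2" "bounded_clinear T\<^sub>3" "bounded_clinear T\<^sub>4"
    using assms(2-5) by (simp_all add: A_adjointable_def)
  let ?w = "A_numerical_radius (op_diag A) (op_matrix T\<^sub>1 T\<^sub>2 T\<^sub>3 T\<^sub>4)"
  note twisted = half_A_numerical_radius_twisted_sum_le[OF A lin]
  have "1 / 2 * A_numerical_radius A (\<lambda>x. T\<^sub>1 x + T\<^sub>2 x + T\<^sub>3 x + T\<^sub>4 x) \<le> ?w"
    using twisted[of 1] by (simp add: scaleC_one)
  moreover have "1 / 2 * A_numerical_radius A (\<lambda>x. T\<^sub>1 x + T\<^sub>4 x - T\<^sub>2 x - T\<^sub>3 x) \<le> ?w"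
    using twisted[of "- 1"] by (simp add: scaleC_minus_one algebra_simps)
  moreover have
    "1 / 2 * A_numerical_radius A (\<lambda>x. T\<^sub>1 x + T\<^sub>4 x + \<i> *\<^sub>C (T\<^sub>2 x - T\<^sub>3 x)) \<le> ?w"
  proof -
    have "T\<^sub>1 x + T\<^sub>4 x + \<i> *\<^sub>C (T\<^sub>2 x - T\<^sub>3 x)
        = T\<^sub>1 x + \<i> *\<^sub>C T\<^sub>2 x + cnj \<i> *\<^sub>C T\<^sub>3 x + T\<^sub>4 x" for x
      by (simp add: scaleC_diff_right scaleC_minus_left)
    then show ?thesis using twisted[of "\<i>"] by (simp only: norm_ii simp_thms)
  qed
  moreover have
    "1 / 2 * A_numerical_radius A (\<lambda>x. T\<^sub>1 x + T\<^sub>4 x - \<i> *\<^sub>C (T\<^sub>2 x - T\<^sub>3 x)) \<le> ?w"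
  proof -
    have "T\<^sub>1 x + T\<^sub>4 x - \<i> *\<^sub>C (T\<^sub>2 x - T\<^sub>3 x)
        = T\<^sub>1 x + (- \<i>) *\<^sub>C T\<^sub>2 x + cnj (- \<i>) *\<^sub>C T\<^sub>3 x + T\<^sub>4 x" for x
      by (simp add: scaleC_diff_right scaleC_minus_left)
    then show ?thesis using twisted[of "- \<i>"] by (simp only: norm_minus_cancel norm_ii simp_thms)
  qed
  ultimately show ?thesis
    by (simp only: max_def simp_thms split: if_split)
qed

end
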